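(* Let $f:[0,\infty)\to(0,\infty)$ be a differentiable mapping and let $a,b\in[0,\infty)$ with $a<b$. Let $m\in(0,1]$, $\mu>0$ and $M>0$. Suppose that $f'\in L[a,b]$, that $|f'|$ is $m$-logarithmically convex on $[0,\infty)$, and that $|f'(x)|\le M$ for all $x\in[0,\infty)$. Then for every $x\in[a,b]$, $$\left|\frac{(x-a)^{\mu}+(b-x)^{\mu}}{b-a}f(x)-\frac{\Gamma(\mu+1)}{b-a}\left[J_{x^-}^{\mu}f(a)+J_{x^+}^{\mu}f(b)\right]\right|\le\left[\frac{1}{2\mu+1}+\frac{M^{2}-M^{2m}}{2\ln M-2m\ln M}\right]\left[\frac{(x-a)^{\mu+1}+(b-x)^{\mu+1}}{2(b-a)}\right],$$ where the quotient $\frac{M^{2}-M^{2m}}{2\ln M-2m\ln M}$, which is formally $0/0$ when $M=1$ or $m=1$, is understood in these cases as its limit: it equals $1$ if $M=1$, and $M^2$ if $m=1$.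
   Context: For $m\in(0,1]$, a function $g:[0,\infty)\to(0,\infty)$ is $m$-logarithmically convex on $[0,\infty)$ if $g(tx+m(1-t)y)\le [g(x)]^{t}[g(y)]^{m(1-t)}$ for all $x,y\in[0,\infty)$ and $t\in[0,1]$. In particular, the hypothesis includes that $|f'|$ takes values in $(0,\infty)$. Riemann-Liouville fractional integrals of order $\mu>0$: $J_{x^-}^{\mu}f(a)=\frac{1}{\Gamma(\mu)}\int_a^x (t-a)^{\mu-1}f(t)\,dt$ and $J_{x^+}^{\mu}f(b)=\frac{1}{\Gamma(\mu)}\int_x^b (b-t)^{\mu-1}f(t)\,dt$, where $\Gamma$ is the Gamma function. $L[a,b]$ denotes the Lebesgue integrable functions on $[a,b]$. *)

theory Defs
  imports "HOL-Analysis.Analysis"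
begin

text \<open>The domain is \<open>[0,\<infinity>)\<close>; values of \<open>g\<close> at negative arguments are irrelevant.\<close>

definition m_log_convex :: "real \<Rightarrow> (real \<Rightarrow> real) \<Rightarrow> bool" where
  "m_log_convex m g \<longleftrightarrow>
     (\<forall>x\<ge>0. 0 < g x) \<and>
     (\<forall>x\<ge>0. \<forall>y\<ge>0. \<forall>t\<in>{0..1}.
        g (t * x + m * (1 - t) * y) \<le> g x powr t * g y powr (m * (1 - t)))"

text \<open>
  Riemann--Liouville fractional integrals of order \<open>\<mu> > 0\<close> with base point \<open>c\<close>:
  \<open>RL_minus \<mu> c f s\<close> is \<open>J\<^bsub>c-\<^esub>\<^bsup>\<mu>\<^esup> f(s)\<close>, meant for \<open>s \<le> c\<close>, and
  \<open>RL_plus \<mu> c f s\<close> is \<open>J\<^bsub>c+\<^esub>\<^bsup>\<mu>\<^esup> f(s)\<close>, meant for \<open>c \<le> s\<close>.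
  The convention \<open>0 powr r = 0\<close> affects the integrands only at the endpoint \<open>t = s\<close>.
\<close>

definition RL_minus :: "real \<Rightarrow> real \<Rightarrow> (real \<Rightarrow> real) \<Rightarrow> real \<Rightarrow> real" where
  "RL_minus \<mu> c f s =
     1 / Gamma \<mu> * (LINT t:{s..c}|lebesgue. (t - s) powr (\<mu> - 1) * f t)"

definition RL_plus :: "real \<Rightarrow> real \<Rightarrow> (real \<Rightarrow> real) \<Rightarrow> real \<Rightarrow> real" where
  "RL_plus \<mu> c f s =
     1 / Gamma \<mu> * (LINT t:{c..s}|lebesgue. (s - t) powr (\<mu> - 1) * f t)"

text \<open>
  The first two cases are the limits of the quotient as \<open>M \<rightarrow> 1\<close> and as \<open>m \<rightarrow> 1\<close>,
  where it is formally \<open>0/0\<close>; they agree at \<open>M = m = 1\<close>.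
\<close>

definition log_quotient :: "real \<Rightarrow> real \<Rightarrow> real" where
  "log_quotient M m =
     (if M = 1 then 1
      else if m = 1 then M\<^sup>2
      else (M\<^sup>2 - M powr (2 * m)) / (2 * ln M - 2 * m * ln M))"

end

theory Submission
  imports Defs
begin

text \<open>
  Integrating the derivative of \<open>(t - a) powr \<mu> * f t\<close> over \<open>[a, x]\<close> gives
  \<open>(x - a) powr \<mu> * f x - Gamma (\<mu> + 1) * RL_minus \<mu> x f a\<close> as the integral of
  \<open>(t - a) powr \<mu> * f' t\<close>, and the side \<open>[x, b]\<close> is its mirror image. Writing
  \<open>t = s * x + (1 - s) * a\<close>, \<open>m\<close>-logarithmic convexity at the points \<open>x\<close> and \<open>a / m\<close> bounds
  \<open>\<bar>f' t\<bar>\<close> by \<open>M powr (s + m * (1 - s))\<close>; the weight \<open>s powr \<mu>\<close> is then separated from it by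
  \<open>u * v \<le> (u\<^sup>2 + v\<^sup>2) / 2\<close>, and the square of the bound integrates to the logarithmic quotient.
\<close>

text \<open>For \<open>M \<noteq> 1\<close> and \<open>m \<noteq> 1\<close> the integrand is an
  exponential with nonzero rate \<open>2 * (1 - m) * ln M\<close>. In the remaining cases it is
  constant, 1 or \<open>M\<^sup>2\<close>, which is the value \<open>log_quotient\<close> takes
  there.\<close>

lemma has_integral_powr_affine_exponent:
  assumes M: "0 < (M::real)"
  shows "((\<lambda>s. (M powr (s + m * (1 - s)))\<^sup>2) has_integral log_quotient M m) {0..1}"
proof (cases "M = 1 \<or> m = 1")
  case True
  then show ?thesis
    using M has_integral_const_real[of "1::real" 0 1] has_integral_const_real[of "M\<^sup>2" 0 1]
    by (auto simp: log_quotient_def)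
next
  case False
  define c where "c = 2 * (1 - m) * ln M"
  have c: "c \<noteq> 0" using False M by (auto simp: c_def)
  have sq: "(M powr (s + m * (1 - s)))\<^sup>2 = exp (2 * m * ln M + c * s)" for s
    using M by (simp add: powr_def c_def exp_double[symmetric] algebra_simps)
  have "((\<lambda>s. exp (2 * m * ln M + c * s)) has_integral
          exp (2 * m * ln M + c * 1) / c - exp (2 * m * ln M + c * 0) / c) {0..1}"
    by (rule fundamental_theorem_of_calculus)
      (use c in \<open>auto intro!: derivative_eq_intros
         simp flip: has_real_derivative_iff_has_vector_derivative\<close>)
  moreover have "exp (2 * m * ln M + c * 1) = M\<^sup>2"
    using M exp_double[of "ln M"] by (simp add: c_def algebra_simps)
  moreover have "exp (2 * m * ln M + c * 0) = M powr (2 * m)"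
    using M by (simp add: powr_def)
  moreover have "c = 2 * ln M - 2 * m * ln M"
    by (simp add: c_def algebra_simps)
  ultimately show ?thesis
    using False by (simp add: log_quotient_def sq diff_divide_distrib)
qed

lemma has_integral_powr_shifted:
  fixes p x \<mu> :: real
  assumes "0 < \<mu>" "p \<le> x"
  shows "((\<lambda>t. (t - p) powr (\<mu> - 1)) has_integral (x - p) powr \<mu> / \<mu>) {p..x}"
proof -
  \<comment> \<open>For \<open>\<mu> < 1\<close> the integrand is unbounded near \<open>p\<close>,
    but the antiderivative stays continuous on \<open>{p..x}\<close>; hence the interior form of the
    fundamental theorem.\<close>
  have "((\<lambda>t. (t - p) powr (\<mu> - 1)) has_integral
          (x - p) powr \<mu> / \<mu> - (p - p) powr \<mu> / \<mu>) {p..x}"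
    by (rule fundamental_theorem_of_calculus_interior)
      (use assms in \<open>auto intro!: derivative_eq_intros continuous_intros continuous_on_powr'
         simp flip: has_real_derivative_iff_has_vector_derivative\<close>)
  then show ?thesis by simp
qed

text \<open>A nonnegative integrable kernel times a bounded measurable function. This identifies the
  Lebesgue integral in \<open>RL_minus\<close> with the gauge integral, to which the fundamental
  theorem applies.\<close>

lemma RL_minus_integrand_absolutely_integrable:
  fixes f :: "real \<Rightarrow> real"
  assumes \<mu>: "0 < \<mu>" and cont: "continuous_on {p..x} f"
  shows "(\<lambda>t. (t - p) powr (\<mu> - 1) * f t) absolutely_integrable_on {p..x}"
proof (cases "p \<le> x")
  case True
  have "(\<lambda>t. (t - p) powr (\<mu> - 1)) absolutely_integrable_on {p..x}"
    using has_integral_powr_shifted[OF \<mu> True]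
    by (intro nonnegative_absolutely_integrable_1) auto
  moreover have "bounded (f ` {p..x})"
    using cont by (intro compact_imp_bounded compact_continuous_image) auto
  ultimately have "(\<lambda>t. f t * (t - p) powr (\<mu> - 1)) absolutely_integrable_on {p..x}"
    using cont
    by (intro absolutely_integrable_bounded_measurable_product_real
        continuous_imp_measurable_on_sets_lebesgue) auto
  then show ?thesis by (simp add: mult.commute)
qed (simp add: absolutely_integrable_on_def)

text \<open>The recurrence \<open>Gamma (\<mu> + 1) = \<mu> * Gamma \<mu>\<close> cancels the
  normalising factor and leaves the integral produced by the product rule.\<close>

lemma Gamma_RL_minus:
  fixes f :: "real \<Rightarrow> real"
  assumes \<mu>: "0 < \<mu>" and cont: "continuous_on {p..x} f"
  shows "Gamma (\<mu> + 1) * RL_minus \<mu> x f p = \<mu> * integral {p..x} (\<lambda>t. (t - p) powr (\<mu> - 1) * f t)"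
proof -
  have "\<mu> \<notin> \<int>\<^sub>\<le>\<^sub>0" using \<mu> by (auto elim!: nonpos_Ints_cases)
  then show ?thesis
    using \<mu> set_lebesgue_integral_eq_integral(2)[OF RL_minus_integrand_absolutely_integrable[OF assms]]
      less_imp_neq[OF Gamma_real_pos[OF \<mu>]]
    by (simp add: RL_minus_def Gamma_plus1)
qed

text \<open>Reflection about 0 reduces the estimate on \<open>{x..b}\<close> to the one for
  integrals based at a left endpoint.\<close>

lemma RL_plus_eq_RL_minus:
  fixes f :: "real \<Rightarrow> real"
  assumes \<mu>: "0 < \<mu>" and cont: "continuous_on {x..q} f"
  shows "RL_plus \<mu> x f q = RL_minus \<mu> (- x) (\<lambda>t. f (- t)) (- q)"
proof -
  let ?h = "\<lambda>t. (q - t) powr (\<mu> - 1) * f t"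
  have "continuous_on {- q..- x} (\<lambda>t. f (- t))"
    by (rule continuous_on_compose2[OF cont]) (auto intro!: continuous_intros)
  from RL_minus_integrand_absolutely_integrable[OF \<mu> this]
  have abs: "(\<lambda>t. ?h (- t)) absolutely_integrable_on {- q..- x}"
    by (simp add: add.commute)
  then have "?h absolutely_integrable_on {x..q}"
    using absolutely_integrable_reflect_real[where f = ?h and a = x and b = q] by blast
  then show ?thesis
    using set_lebesgue_integral_eq_integral(2)[OF abs]
      set_lebesgue_integral_eq_integral(2)[of "{x..q}" ?h] Henstock_Kurzweil_Integration.integral_reflect_real[where f = ?h and a = x and b = q]
    by (simp add: RL_plus_def RL_minus_def add.commute)
qed

text \<open>One half of the inequality. The reflected function lives at negative arguments, so
  convexity enters only through a majorant \<open>k\<close> in the normalised variable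
  \<open>s\<close>, and the same lemma serves both halves.\<close>

lemma RL_minus_error_bound:
  fixes f f' k :: "real \<Rightarrow> real"
  assumes \<mu>: "0 < \<mu>" and px: "p \<le> x"
    and cont: "continuous_on {p..x} f"
    and deriv: "\<And>t. t \<in> {p<..<x} \<Longrightarrow> (f has_real_derivative f' t) (at t)"
    and k_bound: "\<And>s. s \<in> {0..1} \<Longrightarrow> \<bar>f' (s * x + (1 - s) * p)\<bar> \<le> k s"
    and k_int: "((\<lambda>s. (k s)\<^sup>2) has_integral I) {0..1}"
  shows "\<bar>(x - p) powr \<mu> * f x - Gamma (\<mu> + 1) * RL_minus \<mu> x f p\<bar>
         \<le> (1 / (2 * \<mu> + 1) + I) * ((x - p) powr (\<mu> + 1) / 2)"
\<comment> \<open>The rescaling to \<open>{0..1}\<close> divides by \<open>x - p\<close>; for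
  \<open>p = x\<close> both sides are 0.\<close>
proof (cases "p = x")
  case True
  then show ?thesis using Gamma_RL_minus[OF \<mu> cont] by simp
next
  case False
  define L where "L = x - p"
  have L: "0 < L" using False px by (simp add: L_def)
  let ?w = "\<lambda>t. (t - p) powr (\<mu> - 1) * f t"
  let ?g = "\<lambda>t. (t - p) powr \<mu> * f' t"
  \<comment> \<open>\<open>?B\<close> majorises the integrand in the variable \<open>s\<close>;
    \<open>?C\<close> is its transport to \<open>{p..x}\<close> by
    \<open>s = (t - p) / L\<close>.\<close>
  let ?B = "\<lambda>s. L powr \<mu> * ((s powr (2 * \<mu>) + (k s)\<^sup>2) / 2)"
  let ?C = "\<lambda>t. ?B ((t - p) / L)"
  have "((\<lambda>t. \<mu> * ?w t + ?g t) has_integral (x - p) powr \<mu> * f x - (p - p) powr \<mu> * f p) {p..x}"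
  proof (rule fundamental_theorem_of_calculus_interior[OF px])
    show "continuous_on {p..x} (\<lambda>t. (t - p) powr \<mu> * f t)"
      using \<mu> by (intro continuous_intros cont continuous_on_powr') auto
    show "((\<lambda>t. (t - p) powr \<mu> * f t) has_vector_derivative \<mu> * ?w t + ?g t) (at t)"
      if "t \<in> {p<..<x}" for t
      unfolding has_real_derivative_iff_has_vector_derivative[symmetric]
      using that by (auto intro!: derivative_eq_intros deriv)
  qed
  moreover have "((\<lambda>t. \<mu> * ?w t) has_integral \<mu> * integral {p..x} ?w) {p..x}"
    using set_lebesgue_integral_eq_integral(1)[OF RL_minus_integrand_absolutely_integrable[OF \<mu> cont]]
    by (intro has_integral_mult_right integrable_integral)
  \<comment> \<open>Subtracting the kernel part yields integrability of \<open>?g\<close> together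
    with its integral; the boundary term at \<open>p\<close> vanishes because
    \<open>0 powr \<mu> = 0\<close>.\<close>
  ultimately have "((\<lambda>t. \<mu> * ?w t + ?g t - \<mu> * ?w t) has_integral
      (x - p) powr \<mu> * f x - (p - p) powr \<mu> * f p - \<mu> * integral {p..x} ?w) {p..x}"
    by (rule has_integral_diff)
  then have g_int: "(?g has_integral
      (x - p) powr \<mu> * f x - Gamma (\<mu> + 1) * RL_minus \<mu> x f p) {p..x}"
    by (simp add: Gamma_RL_minus[OF \<mu> cont])
  have "((\<lambda>s. s powr (2 * \<mu>)) has_integral 1 / (2 * \<mu> + 1)) {0..1}"
    using has_integral_powr_shifted[of "2 * \<mu> + 1" 0 1] \<mu> by simp
  then have "(?B has_integral L powr \<mu> * ((1 / (2 * \<mu> + 1) + I) / 2)) {0..1}"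
    using k_int by (intro has_integral_mult_right has_integral_divide has_integral_add)
  \<comment> \<open>The substitution contributes the factor \<open>L\<close> that turns
    \<open>L powr \<mu>\<close> into \<open>(x - p) powr (\<mu> + 1)\<close>.\<close>
  then have affine: "((\<lambda>t. ?B ((1 / L) *\<^sub>R t + - p / L)) has_integral
      (L powr \<mu> * ((1 / (2 * \<mu> + 1) + I) / 2)) /\<^sub>R (1 / L) ^ DIM(real))
      (cbox ((0 - - p / L) /\<^sub>R (1 / L)) ((1 - - p / L) /\<^sub>R (1 / L)))"
    using L by (intro has_integral_affinity') auto
  have integrand: "(\<lambda>t. ?B ((1 / L) *\<^sub>R t + - p / L)) = ?C"
    by (simp add: diff_divide_distrib)
  have endpoints: "(0 - - p / L) /\<^sub>R (1 / L) = p" "(1 - - p / L) /\<^sub>R (1 / L) = x"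
    using L by (simp_all add: distrib_left) (simp add: L_def)
  have "(L powr \<mu> * ((1 / (2 * \<mu> + 1) + I) / 2)) /\<^sub>R (1 / L) ^ DIM(real)
      = (1 / (2 * \<mu> + 1) + I) * ((x - p) powr (\<mu> + 1) / 2)"
    using L by (simp add: powr_add flip: L_def)
  with affine have C_int: "(?C has_integral (1 / (2 * \<mu> + 1) + I) * ((x - p) powr (\<mu> + 1) / 2)) {p..x}"
    by (simp only: integrand endpoints cbox_interval)
  have "\<bar>?g t\<bar> \<le> ?C t" if t: "t \<in> {p..x}" for t
  proof -
    define s where "s = (t - p) / L"
    have s: "s \<in> {0..1}" using t L by (auto simp: s_def L_def)
    have tp: "t - p = L * s" using L by (simp add: s_def)
    have "t = s * x + (1 - s) * p" using tp by (simp add: L_def algebra_simps)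
    then have "\<bar>f' t\<bar> \<le> k s" using k_bound[OF s] by simp
    then have "s powr \<mu> * \<bar>f' t\<bar> \<le> s powr \<mu> * k s"
      by (intro mult_left_mono) auto
    also have "\<dots> \<le> ((s powr \<mu>)\<^sup>2 + (k s)\<^sup>2) / 2"
      using sum_squares_bound[of "s powr \<mu>" "k s"] by simp
    also have "(s powr \<mu>)\<^sup>2 = s powr (2 * \<mu>)"
      by (simp add: power2_eq_square flip: powr_add)
    finally have "L powr \<mu> * (s powr \<mu> * \<bar>f' t\<bar>) \<le> ?B s"
      by (intro mult_left_mono) auto
    then show ?thesis
      using L s by (simp add: tp abs_mult powr_mult mult.assoc)
  qed
  then have "norm (integral {p..x} ?g) \<le> integral {p..x} ?C"
    by (intro integral_norm_bound_integral has_integral_integrable[OF g_int]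
        has_integral_integrable[OF C_int]) (simp only: real_norm_def)
  then show ?thesis
    by (simp only: integral_unique[OF g_int] integral_unique[OF C_int] real_norm_def)
qed

text \<open>Convexity pairs \<open>x\<close> with \<open>m\<close> times a second point, so
  \<open>c\<close> is written as \<open>m * (c / m)\<close>. The point \<open>c / m\<close> may lie
  outside the segment from \<open>c\<close> to \<open>x\<close>, which is where the bound on the
  whole half-line enters.\<close>

lemma m_log_convex_bound:
  assumes conv: "m_log_convex m g" and m: "0 < m"
    and bound: "\<And>y. 0 \<le> y \<Longrightarrow> g y \<le> M"
    and xc: "0 \<le> x" "0 \<le> c" and s: "s \<in> {0..1}"
  shows "g (s * x + (1 - s) * c) \<le> M powr (s + m * (1 - s))"
proof -
  have pos: "0 < g y" if "0 \<le> y" for y using conv that by (auto simp: m_log_convex_def)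
  have cm: "0 \<le> c / m" using xc m by simp
  have "g (s * x + (1 - s) * c) = g (s * x + m * (1 - s) * (c / m))"
    using m by (simp add: mult.commute)
  also have "\<dots> \<le> g x powr s * g (c / m) powr (m * (1 - s))"
    using conv xc cm s unfolding m_log_convex_def by blast
  also have "\<dots> \<le> M powr s * M powr (m * (1 - s))"
    using s m pos xc cm bound by (intro mult_mono powr_mono2) (auto intro: less_imp_le)
  finally show ?thesis by (simp add: powr_add)
qed

theorem corollary1:
  fixes f f' :: "real \<Rightarrow> real" and a b m \<mu> M x :: real
  assumes f_pos: "\<And>y. 0 \<le> y \<Longrightarrow> 0 < f y"
    and f_deriv: "\<And>y. 0 \<le> y \<Longrightarrow> (f has_real_derivative f' y) (at y within {0..})"
    and ab: "0 \<le> a" "a < b"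
    and m: "0 < m" "m \<le> 1"
    and \<mu>: "0 < \<mu>"
    and M: "0 < M"
    and f'_int: "f' absolutely_integrable_on {a..b}"
    and f'_conv: "m_log_convex m (\<lambda>y. \<bar>f' y\<bar>)"
    and f'_bound: "\<And>y. 0 \<le> y \<Longrightarrow> \<bar>f' y\<bar> \<le> M"
    and x: "x \<in> {a..b}"
  shows "\<bar>((x - a) powr \<mu> + (b - x) powr \<mu>) / (b - a) * f x
            - Gamma (\<mu> + 1) / (b - a) * (RL_minus \<mu> x f a + RL_plus \<mu> x f b)\<bar>
         \<le> (1 / (2 * \<mu> + 1) + log_quotient M m)
            * (((x - a) powr (\<mu> + 1) + (b - x) powr (\<mu> + 1)) / (2 * (b - a)))"
proof -
  let ?k = "\<lambda>s. M powr (s + m * (1 - s))"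
  let ?K = "1 / (2 * \<mu> + 1) + log_quotient M m"
  let ?A = "(x - a) powr \<mu> * f x - Gamma (\<mu> + 1) * RL_minus \<mu> x f a"
  let ?B = "(b - x) powr \<mu> * f x - Gamma (\<mu> + 1) * RL_plus \<mu> x f b"
  have x0: "0 \<le> x" "a \<le> x" "x \<le> b" using x ab by auto
  have cont: "continuous_on S f" if "S \<subseteq> {0..}" for S
    using f_deriv that by (intro continuous_on_subset[OF _ that] DERIV_continuous_on) auto
  \<comment> \<open>At 0 the derivative is only one-sided, but the points of the open interval from
    \<open>a\<close> to \<open>x\<close>, or from \<open>x\<close> to \<open>b\<close>, are
    positive.\<close>
  have deriv: "(f has_real_derivative f' t) (at t)" if "0 < t" for t
    using f_deriv[of t] that at_within_interior[of t "{0..}"] by (simp add: interior_real_atLeast)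
  have k_bound: "\<bar>f' (s * x + (1 - s) * c)\<bar> \<le> ?k s" if "s \<in> {0..1}" "0 \<le> c" for s c
    using m_log_convex_bound[OF f'_conv m(1) f'_bound] x0 that by simp
  have left: "\<bar>?A\<bar> \<le> ?K * ((x - a) powr (\<mu> + 1) / 2)"
    by (rule RL_minus_error_bound[where f' = f' and k = ?k])
      (use \<mu> M x0 ab in \<open>auto intro!: cont deriv k_bound has_integral_powr_affine_exponent\<close>)
  \<comment> \<open>The right half is the left estimate for the reflected function on
    \<open>{- b..- x}\<close>. Negating \<open>s * (- x) + (1 - s) * (- b)\<close> gives
    \<open>s * x + (1 - s) * b\<close>, so the majorant \<open>?k\<close> is unchanged.\<close>
  have "\<bar>(- x - (- b)) powr \<mu> * f (- (- x)) - Gamma (\<mu> + 1) * RL_minus \<mu> (- x) (\<lambda>t. f (- t)) (- b)\<bar>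
      \<le> ?K * ((- x - (- b)) powr (\<mu> + 1) / 2)"
  proof (rule RL_minus_error_bound[where f' = "\<lambda>t. - f' (- t)" and k = ?k])
    show "continuous_on {- b..- x} (\<lambda>t. f (- t))"
      using x0 by (intro continuous_on_compose2[OF cont[of "{x..b}"]]) (auto intro!: continuous_intros)
    show "((\<lambda>t. f (- t)) has_real_derivative - f' (- t)) (at t)" if "t \<in> {- b<..<- x}" for t
    proof -
      have "((\<lambda>t. f (- t)) has_real_derivative f' (- t) * - 1) (at t)"
        by (rule DERIV_chain2[where f = f and g = uminus])
          (use that x0 in \<open>auto intro!: deriv derivative_eq_intros\<close>)
      then show ?thesis by simp
    qed
    show "\<bar>- f' (- (s * (- x) + (1 - s) * (- b)))\<bar> \<le> ?k s" if "s \<in> {0..1}" for s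
      using k_bound[OF that, of b] ab by (simp add: add.commute)
  qed (use \<mu> M x0 in \<open>auto intro!: has_integral_powr_affine_exponent\<close>)
  then have right: "\<bar>?B\<bar> \<le> ?K * ((b - x) powr (\<mu> + 1) / 2)"
    using RL_plus_eq_RL_minus[OF \<mu> cont[of "{x..b}"]] x0 by simp
  have "((x - a) powr \<mu> + (b - x) powr \<mu>) / (b - a) * f x
          - Gamma (\<mu> + 1) / (b - a) * (RL_minus \<mu> x f a + RL_plus \<mu> x f b) = (?A + ?B) / (b - a)"
    by (simp add: add_divide_distrib diff_divide_distrib algebra_simps)
  also have "\<bar>\<dots>\<bar> \<le> (?K * ((x - a) powr (\<mu> + 1) / 2) + ?K * ((b - x) powr (\<mu> + 1) / 2)) / (b - a)"
    using ab order_trans[OF abs_triangle_ineq add_mono[OF left right]]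
    by (simp only: abs_divide) (simp add: divide_right_mono)
  also have "\<dots> = ?K * (((x - a) powr (\<mu> + 1) + (b - x) powr (\<mu> + 1)) / (2 * (b - a)))"
    by (simp add: add_divide_distrib distrib_left)
  finally show ?thesis .
qed

end
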